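(* Let $0<\alpha<1$ and $0\le\beta\le1$. Then the function $$\Phi_{\alpha,\beta}(s)=\frac{s^\alpha}{\bigl(1+(1-\alpha)s^{\alpha-1}\bigr)^\beta},\qquad s>0,$$ belongs to $\mathcal{BF}$.
   Context: $\mathcal{CM}$ is the class of completely monotone functions: $g\in C^\infty(0,\infty)$ with $(-1)^n g^{(n)}(s)\ge 0$ for all integers $n\ge 0$ and all $s>0$. $\mathcal{BF}$ is the class of Bernstein functions: $f\in C^\infty(0,\infty)$ with $f(s)\ge 0$ for all $s>0$ and $f'\in\mathcal{CM}$. *)

theory Defs
  imports "HOL-Analysis.Analysis"
begin

(* Functions on (0,infinity) are represented by total functions real => real; their values
   on the nonpositive reals are irrelevant, since (0,infinity) is open and the iterated
   derivatives at a point s > 0 only depend on the function near s.  As deriv is a total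
   operator, smoothness requires every iterate to be differentiable. *)

definition smooth_pos :: "(real \<Rightarrow> real) set" where
  "smooth_pos = {f. \<forall>n. \<forall>s>0. (deriv ^^ n) f field_differentiable (at s)}"

definition completely_monotone :: "(real \<Rightarrow> real) set" where
  "completely_monotone =
     {g \<in> smooth_pos. \<forall>n. \<forall>s>0. (- 1) ^ n * (deriv ^^ n) g s \<ge> 0}"

definition bernstein_functions :: "(real \<Rightarrow> real) set" where
  "bernstein_functions =
     {f \<in> smooth_pos. (\<forall>s>0. f s \<ge> 0) \<and> deriv f \<in> completely_monotone}"

definition Phi :: "real \<Rightarrow> real \<Rightarrow> real \<Rightarrow> real" where
  "Phi \<alpha> \<beta> s = s powr \<alpha> / (1 + (1 - \<alpha>) * s powr (\<alpha> - 1)) powr \<beta>"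

end

(* With c = 1 - \<alpha> and v = s^c one computes
     \<Phi>'(s) = \<alpha> v^(\<beta>-1) (v+c)^(-\<beta>) + \<beta> c^2 v^(\<beta>-1) (v+c)^(-\<beta>-1).
   Since s |-> (s^c + d)^(-p) is completely monotone for p, d \<ge> 0, and complete monotonicity is
   preserved by sums, products and nonnegative multiples, so is \<Phi>'. *)
theory Submission
  imports Defs
begin

(* Truncating complete monotonicity at finite order makes induction on the order available. *)
primrec cm_upto :: "nat \<Rightarrow> (real \<Rightarrow> real) \<Rightarrow> bool" where
  "cm_upto 0 f \<longleftrightarrow> (\<forall>s>0. f s \<ge> 0)"
| "cm_upto (Suc n) f \<longleftrightarrow> (\<forall>s>0. f s \<ge> 0) \<and>
     (\<exists>g. cm_upto n g \<and> (\<forall>s>0. (f has_real_derivative - g s) (at s)))"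

lemma cm_upto_nonneg: "cm_upto n f \<Longrightarrow> s > 0 \<Longrightarrow> f s \<ge> 0"
  by (cases n) auto

lemma cm_upto_SucI:
  assumes "\<And>s. s > 0 \<Longrightarrow> f s \<ge> 0" "cm_upto n g"
    and "\<And>s. s > 0 \<Longrightarrow> (f has_real_derivative - g s) (at s)"
  shows "cm_upto (Suc n) f"
  using assms by auto

lemma has_real_derivative_cong_pos:
  fixes f g :: "real \<Rightarrow> real"
  assumes "\<And>s. s > 0 \<Longrightarrow> f s = g s" "s > 0" "(f has_real_derivative D) (at s)"
  shows "(g has_real_derivative D) (at s)"
  using has_field_derivative_transform_within_open[OF assms(3), of "{0<..}" g] assms(1,2) by auto

text \<open>The half-line is open, so both values and derivatives there are unaffected by what a
  function does elsewhere. This permits replacing a function by a formula valid only for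
  \<open>s > 0\<close>.\<close>

lemma cm_upto_cong:
  assumes "\<And>s. s > 0 \<Longrightarrow> f s = g s" "cm_upto n f"
  shows "cm_upto n g"
proof (cases n)
  case 0
  then show ?thesis using assms by simp
next
  case (Suc m)
  then obtain f1 where "cm_upto m f1" "\<forall>s>0. (f has_real_derivative - f1 s) (at s)"
    using assms(2) by auto
  moreover have "g s \<ge> 0" if "s > 0" for s
    using assms that by (metis cm_upto_nonneg)
  ultimately show ?thesis
    unfolding Suc using has_real_derivative_cong_pos[OF assms(1)] by (intro cm_upto_SucI) auto
qed

lemma cm_upto_SucD: "cm_upto (Suc n) f \<Longrightarrow> cm_upto n f"
  by (induction n arbitrary: f) auto

lemma cm_upto_const: "k \<ge> 0 \<Longrightarrow> cm_upto n (\<lambda>s. k)"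
  by (induction n arbitrary: k) (auto intro!: exI[of _ "\<lambda>s. 0"])

lemma cm_upto_add: "cm_upto n f \<Longrightarrow> cm_upto n g \<Longrightarrow> cm_upto n (\<lambda>s. f s + g s)"
proof (induction n arbitrary: f g)
  case 0
  then show ?case by simp
next
  case (Suc n)
  obtain f1 where f1: "cm_upto n f1" "\<forall>s>0. (f has_real_derivative - f1 s) (at s)"
    using Suc.prems by auto
  obtain g1 where g1: "cm_upto n g1" "\<forall>s>0. (g has_real_derivative - g1 s) (at s)"
    using Suc.prems by auto
  show ?case
  proof (rule cm_upto_SucI)
    show "cm_upto n (\<lambda>s. f1 s + g1 s)"
      using Suc.IH f1 g1 by blast
  qed (use Suc.prems f1 g1 in \<open>auto intro!: derivative_eq_intros\<close>)
qed

text \<open>By the Leibniz rule, \<open>-(f g)' = f1 g + f g1\<close> with \<open>f1 = -f'\<close>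
  and \<open>g1 = -g'\<close>. Each summand is a product at order \<open>n\<close>, once the
  undifferentiated factor is lowered by \<open>cm_upto_SucD\<close>.\<close>

lemma cm_upto_mult: "cm_upto n f \<Longrightarrow> cm_upto n g \<Longrightarrow> cm_upto n (\<lambda>s. f s * g s)"
proof (induction n arbitrary: f g)
  case 0
  then show ?case by simp
next
  case (Suc n)
  obtain f1 where f1: "cm_upto n f1" "\<forall>s>0. (f has_real_derivative - f1 s) (at s)"
    using Suc.prems by auto
  obtain g1 where g1: "cm_upto n g1" "\<forall>s>0. (g has_real_derivative - g1 s) (at s)"
    using Suc.prems by auto
  show ?case
  proof (rule cm_upto_SucI)
    show "cm_upto n (\<lambda>s. f1 s * g s + f s * g1 s)"
      using Suc.IH f1 g1 Suc.prems cm_upto_SucD by (intro cm_upto_add) blast+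
  qed (use Suc.prems f1 g1 in \<open>auto intro!: derivative_eq_intros simp: algebra_simps\<close>)
qed

text \<open>The negated derivative is \<open>p\<close> times the same function with exponent
  parameter \<open>p + 1\<close>, hence the induction for arbitrary \<open>p\<close>.\<close>

lemma cm_upto_powr:
  assumes "p \<ge> 0"
  shows "cm_upto n (\<lambda>s. s powr (- p))"
  using assms
proof (induction n arbitrary: p)
  case 0
  then show ?case by simp
next
  case (Suc n)
  show ?case
  proof (rule cm_upto_SucI)
    show "cm_upto n (\<lambda>s. p * s powr (- (p + 1)))"
      using Suc.prems by (intro cm_upto_mult cm_upto_const Suc.IH) auto
  qed (auto intro!: derivative_eq_intros simp: algebra_simps minus_diff_commute)
qed

text \<open>The negated derivative is \<open>p c s^(-(1-c)) (s^c + d)^(-(p+1))\<close>. The middle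
  factor is a nonpositive power because \<open>c \<le> 1\<close>, and the last one is the induction
  hypothesis at \<open>p + 1\<close>. No general theorem on compositions is involved.\<close>

lemma cm_upto_powr_shift_powr:
  assumes "0 < c" "c \<le> 1" "d \<ge> 0" "p \<ge> 0"
  shows "cm_upto n (\<lambda>s. (s powr c + d) powr (- p))"
  using assms(4)
proof (induction n arbitrary: p)
  case 0
  then show ?case by simp
next
  case (Suc n)
  show ?case
  proof (rule cm_upto_SucI)
    have "cm_upto n (\<lambda>s. s powr (- (1 - c)))"
      using assms by (intro cm_upto_powr) auto
    then show "cm_upto n (\<lambda>s. (p * c) * s powr (- (1 - c)) * (s powr c + d) powr (- (p + 1)))"
      using Suc.prems assms by (intro cm_upto_mult cm_upto_const Suc.IH) auto
  next
    fix s :: real assume "s > 0"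
    moreover have "s powr c + d > 0"
      using \<open>s > 0\<close> assms by (simp add: add_pos_nonneg)
    ultimately show "((\<lambda>s. (s powr c + d) powr (- p)) has_real_derivative
        - ((p * c) * s powr (- (1 - c)) * (s powr c + d) powr (- (p + 1)))) (at s)"
      by (auto intro!: derivative_eq_intros simp: algebra_simps minus_diff_commute)
  qed auto
qed

text \<open>Passes from the existential witness of \<open>cm_upto\<close>, fixed only on the
  positive reals, to the total operator \<open>deriv\<close> used in the definitions of the function
  classes.\<close>

lemma cm_upto_deriv:
  assumes "cm_upto (Suc n) f"
  shows "cm_upto n (\<lambda>s. - deriv f s)"
    and "s > 0 \<Longrightarrow> (f has_real_derivative deriv f s) (at s)"
proof -
  obtain g where g: "cm_upto n g" "\<And>s. s > 0 \<Longrightarrow> (f has_real_derivative - g s) (at s)"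
    using assms by auto
  have deriv: "deriv f s = - g s" if "s > 0" for s
    using g(2)[OF that] by (rule DERIV_imp_deriv)
  show "cm_upto n (\<lambda>s. - deriv f s)"
    using g(1) by (rule cm_upto_cong[rotated]) (simp add: deriv)
  show "(f has_real_derivative deriv f s) (at s)" if "s > 0"
    using g(2) deriv that by simp
qed

lemma completely_monotoneI:
  assumes "\<And>n. cm_upto n f"
  shows "f \<in> completely_monotone"
proof -
  \<comment> \<open>The two signs cancel, so differentiability of the signed iterate transfers to
    the iterate itself.\<close>
  have eq: "(\<lambda>s. (- 1) ^ k * ((- 1) ^ k * (deriv ^^ k) f s)) = (deriv ^^ k) f" for k
    by (simp flip: mult.assoc power_mult_distrib)
  have diff: "((deriv ^^ k) f has_real_derivative
      (- 1) ^ k * deriv (\<lambda>s. (- 1) ^ k * (deriv ^^ k) f s) s) (at s)"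
    if "cm_upto (Suc n) (\<lambda>s. (- 1) ^ k * (deriv ^^ k) f s)" "s > 0" for n k s
    using DERIV_cmult[OF cm_upto_deriv(2)[OF that], of "(- 1) ^ k"] unfolding eq .
  \<comment> \<open>Each differentiation costs one order, so the step for \<open>n\<close> uses the
    hypothesis at \<open>Suc n\<close>; this is why \<open>n\<close> stays arbitrary.\<close>
  have cm: "cm_upto n (\<lambda>s. (- 1) ^ k * (deriv ^^ k) f s)" for n k
  proof (induction k arbitrary: n)
    case 0
    then show ?case using assms by simp
  next
    case (Suc k)
    show ?case
      using cm_upto_deriv(1)[OF Suc]
      by (rule cm_upto_cong[rotated])
        (simp add: DERIV_imp_deriv[OF diff[OF Suc]] flip: mult.assoc power_mult_distrib)
  qed
  show ?thesis
    using cm_upto_nonneg[OF cm] diff[OF cm]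
    unfolding completely_monotone_def smooth_pos_def field_differentiable_def by blast
qed

lemma bernstein_functionsI:
  assumes "\<And>s. s > 0 \<Longrightarrow> f s \<ge> 0" "\<And>n. cm_upto n g"
    and "\<And>s. s > 0 \<Longrightarrow> (f has_real_derivative g s) (at s)"
  shows "f \<in> bernstein_functions"
proof -
  have "cm_upto n (deriv f)" for n
    using assms(2) by (rule cm_upto_cong[rotated]) (use assms(3) DERIV_imp_deriv in force)
  then have cm: "deriv f \<in> completely_monotone"
    by (rule completely_monotoneI)
  have "(deriv ^^ n) f field_differentiable (at s)" if "s > 0" for n s
  proof (cases n)
    case 0
    then show ?thesis using assms(3)[OF that] by (auto simp: field_differentiable_def)
  next
    case (Suc m)
    then show ?thesis
      using cm that
      \<comment> \<open>The iterate of order \<open>Suc m\<close> of \<open>f\<close> must be read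
        as the iterate of order \<open>m\<close> of \<open>deriv f\<close>, so the innermost
        \<open>deriv\<close> is split off instead of the outermost.\<close>
      by (simp add: completely_monotone_def smooth_pos_def funpow_Suc_right del: funpow.simps)
  qed
  then show ?thesis
    using cm assms(1) by (simp add: bernstein_functions_def smooth_pos_def)
qed

text \<open>Pulling \<open>s^(-c)\<close> out of the denominator leaves powers of \<open>s\<close>
  and of \<open>s^c + c\<close> only. The derivative thus becomes a nonnegative combination of
  products of the two families already shown to be completely monotone.\<close>

lemma Phi_has_derivative:
  fixes \<alpha> \<beta> s :: real
  assumes "\<alpha> < 1" "s > 0"
  defines "c \<equiv> 1 - \<alpha>"
  shows "(Phi \<alpha> \<beta> has_real_derivative
     \<alpha> * (s powr (- (c * (1 - \<beta>))) * (s powr c + c) powr (- \<beta>)) +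
     \<beta> * c\<^sup>2 * (s powr (- (c * (1 - \<beta>))) * (s powr c + c) powr (- (\<beta> + 1)))) (at s)"
proof -
  define w where "w = s powr c + c"
  have c: "c > 0" using assms by simp
  have w: "w > 0" using assms c by (simp add: w_def add_pos_pos)
  have base: "1 + c * s powr (- c) = s powr (- c) * w"
    using assms by (simp add: w_def algebra_simps flip: powr_add)
  have eq: "Phi \<alpha> \<beta> = (\<lambda>t. t powr \<alpha> * (1 + c * t powr (- c)) powr (- \<beta>))"
    by (rule ext) (simp add: Phi_def c_def powr_minus divide_inverse)
  have pos: "1 + c * s powr (- c) > 0"
    using c by (simp add: add_pos_nonneg)
  have pw: "(1 + c * s powr (- c)) powr q = s powr (- c * q) * w powr q" for q
    unfolding base using w by (simp add: powr_mult powr_powr)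
  have "(Phi \<alpha> \<beta> has_real_derivative
      \<alpha> * s powr (\<alpha> - 1) * (1 + c * s powr (- c)) powr (- \<beta>) +
      s powr \<alpha> * (\<beta> * c * c * s powr (- c - 1) * (1 + c * s powr (- c)) powr (- \<beta> - 1))) (at s)"
    unfolding eq using pos assms(2)
    by (auto intro!: derivative_eq_intros simp: algebra_simps)
  also have "\<alpha> * s powr (\<alpha> - 1) * (1 + c * s powr (- c)) powr (- \<beta>) =
      \<alpha> * (s powr (\<alpha> - 1 + c * \<beta>) * w powr (- \<beta>))"
    unfolding pw by (simp add: powr_add)
  also have "s powr \<alpha> * (\<beta> * c * c * s powr (- c - 1) * (1 + c * s powr (- c)) powr (- \<beta> - 1)) =
      \<beta> * c\<^sup>2 * (s powr (\<alpha> + (- c - 1) + c * (\<beta> + 1)) * w powr (- (\<beta> + 1)))"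
    unfolding pw powr_add by (simp add: power2_eq_square algebra_simps minus_diff_commute)
  \<comment> \<open>Since \<open>\<alpha> = 1 - c\<close>, the exponents of \<open>s\<close> in both
    terms collapse to the same value.\<close>
  also have "\<alpha> - 1 + c * \<beta> = - (c * (1 - \<beta>))"
    by (simp add: c_def algebra_simps)
  also have "\<alpha> + (- c - 1) + c * (\<beta> + 1) = - (c * (1 - \<beta>))"
    by (simp add: c_def algebra_simps)
  finally show ?thesis
    by (simp add: w_def)
qed

theorem theorem3p5:
  fixes \<alpha> \<beta> :: real
  assumes "0 < \<alpha>" "\<alpha> < 1" and "0 \<le> \<beta>" "\<beta> \<le> 1"
  shows "Phi \<alpha> \<beta> \<in> bernstein_functions"
proof (rule bernstein_functionsI)
  show "Phi \<alpha> \<beta> s \<ge> 0" for s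
    by (simp add: Phi_def)
  show "cm_upto n (\<lambda>s. \<alpha> * (s powr (- ((1 - \<alpha>) * (1 - \<beta>))) * (s powr (1 - \<alpha>) + (1 - \<alpha>)) powr (- \<beta>)) +
     \<beta> * (1 - \<alpha>)\<^sup>2 * (s powr (- ((1 - \<alpha>) * (1 - \<beta>))) * (s powr (1 - \<alpha>) + (1 - \<alpha>)) powr (- (\<beta> + 1))))" for n
    using assms
    \<comment> \<open>The bound \<open>\<beta> \<le> 1\<close> makes
      \<open>(1 - \<alpha>) * (1 - \<beta>)\<close> nonnegative, as \<open>cm_upto_powr\<close>
      demands; \<open>0 < \<alpha>\<close> gives the condition \<open>1 - \<alpha> \<le> 1\<close>
      of \<open>cm_upto_powr_shift_powr\<close> and a nonnegative first coefficient.\<close>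
    by (intro cm_upto_add cm_upto_mult cm_upto_const cm_upto_powr cm_upto_powr_shift_powr) auto
qed (use Phi_has_derivative assms in blast)

end
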